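(* Let $\Delta^n f(s)=\sum_{\nu=0}^n(-1)^{n-\nu}\binom{n}{\nu}f(s+\nu)$ denote the forward difference (acting on $x$). For $n\ge1$ let \[ \mathfrak{p}_n(x)=\sum_{\nu=0}^n(-1)^\nu 2^{n-\nu}\binom{x+\nu}{\nu}\,\Delta^\nu (x+1)^n,\qquad \binom{x+\nu}{\nu}=\frac{(x+\nu)\cdots(x+1)}{\nu!}. \] For even $n\ge4$ one has $\mathfrak{p}_n(x)=x(x+1)\,\mathfrak{q}_n(x)$ with $\mathfrak{q}_n\in\mathbb{Z}[x]$ monic of degree $n-2$. Let $p$ be an odd prime and $n=p+1$. Then $\mathfrak{q}_n$ is an Eisenstein polynomial, and consequently $\mathfrak{q}_n$ is irreducible over $\mathbb{Z}[x]$. *)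

theory Defs
  imports "HOL-Computational_Algebra.Computational_Algebra"
begin

text \<open>The shift \<open>f(x + \<nu>)\<close> of a polynomial \<open>f\<close> is its composition with \<open>[:\<nu>, 1:]\<close>.\<close>

definition fwd_diff :: "nat \<Rightarrow> 'a::comm_ring_1 poly \<Rightarrow> 'a poly" where
  "fwd_diff n f =
     (\<Sum>\<nu>\<le>n. smult ((-1) ^ (n - \<nu>) * of_nat (n choose \<nu>)) (f \<circ>\<^sub>p [:of_nat \<nu>, 1:]))"

text \<open>The polynomial \<open>(x + \<nu>) \<cdots> (x + 1) / \<nu>!\<close>.\<close>

definition binom_poly :: "nat \<Rightarrow> rat poly" where
  "binom_poly \<nu> = smult (1 / fact \<nu>) (\<Prod>j=1..\<nu>. [:of_nat j, 1:])"

definition pfrak :: "nat \<Rightarrow> rat poly" where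
  "pfrak n =
     (\<Sum>\<nu>\<le>n. smult ((-1) ^ \<nu> * 2 ^ (n - \<nu>)) (binom_poly \<nu> * fwd_diff \<nu> ([:1, 1:] ^ n)))"

text \<open>
  The quotient of \<open>pfrak n\<close> by \<open>x (x + 1)\<close>, as a polynomial over the integers. There is at
  most one such polynomial; the description is meaningful only when one exists.
\<close>

definition qfrak :: "nat \<Rightarrow> int poly" where
  "qfrak n = (THE q. pfrak n = [:0, 1:] * [:1, 1:] * map_poly of_int q)"

text \<open>
  The hypotheses of Eisenstein's criterion at \<open>p\<close>. Constant polynomials are excluded.
\<close>

definition eisenstein_at :: "int \<Rightarrow> int poly \<Rightarrow> bool" where
  "eisenstein_at p f \<longleftrightarrow>
     prime p \<and> degree f > 0 \<and> \<not> p dvd lead_coeff f \<and>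
     (\<forall>i<degree f. p dvd coeff f i) \<and> \<not> p ^ 2 dvd coeff f 0"

end

theory Submission
  imports Defs "HOL-Number_Theory.Cong"
begin

text \<open>
  Write \<open>P\<^sub>n\<close> for \<open>pfrak n\<close> and \<open>Q\<^sub>n\<close> for \<open>qfrak n\<close>. A Leibniz rule for differences gives the recursion
  \<open>P\<^sub>n\<^sub>+\<^sub>1(x) = (x + 1) (2 P\<^sub>n(x) - P\<^sub>n(x + 1))\<close>, which shows that \<open>P\<^sub>n\<close> is monic with integer
  coefficients and that \<open>P\<^sub>n(a)\<close> is the \<open>n\<close>-th derivative of \<open>(1 + tanh t) ^ (a + 1)\<close> at \<open>0\<close>.
  As \<open>tanh\<close> is odd, \<open>x\<close> divides \<open>P\<^sub>n\<close> for even \<open>n\<close>; differentiating in \<open>a\<close> with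
  \<open>ln (1 + tanh t) = t - ln (cosh t)\<close> gives \<open>Q\<^sub>n(0) = (n - 1) P\<^sub>n\<^sub>-\<^sub>1(0)\<close>.

  Now let \<open>n = p + 1\<close>. Modulo \<open>p\<close>, Fermat turns \<open>(x + 1) ^ p\<close> into \<open>x + 1\<close> in the definition of
  \<open>P\<^sub>p\<close>, so only the differences of order 0 and 1 survive and \<open>P\<^sub>p(a) \<equiv> a + 1\<close> for all \<open>a\<close>. Hence the
  monic polynomial \<open>x Q\<^sub>n(x) = 2 P\<^sub>p(x) - P\<^sub>p(x + 1)\<close> of degree \<open>p\<close> takes the values \<open>a \<equiv> a ^ p\<close>, and
  therefore equals \<open>x ^ p\<close> modulo \<open>p\<close>; moreover \<open>Q\<^sub>n(0) = p P\<^sub>p(0)\<close> with \<open>P\<^sub>p(0) \<equiv> 1\<close>.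
\<close>

section \<open>Forward differences of integer functions\<close>

text \<open>Integer functions on the naturals allow congruences modulo \<open>p\<close> under the
  differences; polynomial identities are recovered from their values at all naturals.\<close>

fun fdiff :: "nat \<Rightarrow> (nat \<Rightarrow> int) \<Rightarrow> nat \<Rightarrow> int" where
  "fdiff 0 f a = f a"
| "fdiff (Suc k) f a = fdiff k f (Suc a) - fdiff k f a"

lemma fdiff_eq_sum:
  "fdiff k f a = (\<Sum>j\<le>k. (-1) ^ (k - j) * int (k choose j) * f (a + j))"
proof (induction k arbitrary: a)
  case 0
  then show ?case by simp
next
  case (Suc k)
  let ?s = "\<lambda>j. (-1) ^ (k - j) * int (k choose j)"
  have "(\<Sum>j\<le>Suc k. (-1) ^ (Suc k - j) * int (Suc k choose j) * f (a + j)) =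
      (-1) ^ Suc k * f a + (\<Sum>j\<le>k. (-1) ^ (k - j) * int (Suc k choose Suc j) * f (a + Suc j))"
    by (subst sum.atMost_Suc_shift) simp
  also have "(\<Sum>j\<le>k. (-1) ^ (k - j) * int (Suc k choose Suc j) * f (a + Suc j)) =
      (\<Sum>j\<le>k. ?s j * f (Suc a + j)) + (\<Sum>j\<le>k. (-1) ^ (k - j) * int (k choose Suc j) * f (a + Suc j))"
    by (simp add: sum.distrib[symmetric] algebra_simps)
  \<comment> \<open>With one sign pulled out, the summand depends on \<open>Suc j\<close> only, so
    the sum is an index shift. The new top term vanishes because
    \<open>k choose Suc k = 0\<close>.\<close>
  also have "(\<Sum>j\<le>k. (-1) ^ (k - j) * int (k choose Suc j) * f (a + Suc j)) =
      - (\<Sum>j\<le>k. (-1) ^ (Suc k - Suc j) * - (int (k choose Suc j) * f (a + Suc j)))"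
    by (simp add: sum_negf[symmetric] mult.assoc)
  also have "(\<Sum>j\<le>k. (-1) ^ (Suc k - Suc j) * - (int (k choose Suc j) * f (a + Suc j))) =
      (\<Sum>j\<le>Suc k. - ((-1) ^ (Suc k - j) * int (k choose j) * f (a + j))) + (-1) ^ Suc k * f a"
    by (subst sum.atMost_Suc_shift[of _ k]) (simp add: mult.assoc)
  also have "(\<Sum>j\<le>Suc k. - ((-1) ^ (Suc k - j) * int (k choose j) * f (a + j))) =
      (\<Sum>j\<le>k. ?s j * f (a + j))"
    by (intro sum.mono_neutral_cong_right) (auto simp: Suc_diff_le binomial_eq_0)
  finally show ?case
    by (simp add: Suc.IH)
qed

text \<open>Leibniz rule for the linear factor \<open>a + 1\<close>, whose differences of order
  above 1 vanish.\<close>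

lemma fdiff_Suc_mult:
  "fdiff (Suc k) (\<lambda>a. (int a + 1) * g a) a =
     (int a + int k + 2) * fdiff (Suc k) g a + (int k + 1) * fdiff k g a"
proof (induction k arbitrary: a)
  case 0
  then show ?case by (simp add: algebra_simps)
next
  case (Suc k)
  show ?case
    by (subst fdiff.simps(2), simp only: Suc.IH, simp add: algebra_simps)
qed

text \<open>For \<open>k = 0\<close> the truncated \<open>k - 1\<close> is harmless, since its term
  carries the factor \<open>k\<close>.\<close>

lemma fdiff_mult:
  "fdiff k (\<lambda>a. (int a + 1) * g a) a =
     (int a + int k + 1) * fdiff k g a + int k * fdiff (k - 1) g a"
  using fdiff_Suc_mult[of "k - 1" g a] by (cases k) (simp_all add: algebra_simps)

lemma fdiff_power_eq_0: "n < k \<Longrightarrow> fdiff k (\<lambda>a. (int a + 1) ^ n) a = 0"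
proof (induction n arbitrary: k a)
  case 0
  have "fdiff (Suc j) (\<lambda>a. 1) b = 0" for j b
    by (induction j arbitrary: b) auto
  then show ?case using 0 by (cases k) auto
next
  case (Suc n)
  then show ?case
    by (simp add: fdiff_mult)
qed

lemma fdiff_cong_mod:
  assumes "\<And>a. [f a = g a] (mod m)"
  shows "[fdiff k f a = fdiff k g a] (mod m)"
  by (induction k arbitrary: a) (auto intro: assms cong_diff)

section \<open>The defining sum and its recursion\<close>

text \<open>For \<open>f a = (a + 1) ^ n\<close> this is the value of \<open>pfrak n\<close> at
  \<open>a\<close>. A general \<open>f\<close> lets the factors \<open>a + 1\<close> be split off
  one at a time.\<close>

definition euler_sum :: "nat \<Rightarrow> (nat \<Rightarrow> int) \<Rightarrow> nat \<Rightarrow> int" where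
  "euler_sum n f a =
     (\<Sum>\<nu>\<le>n. (-1) ^ \<nu> * 2 ^ (n - \<nu>) * int ((a + \<nu>) choose \<nu>) * fdiff \<nu> f a)"

text \<open>Division-free rules that bring the binomials at \<open>Suc k\<close> and at
  \<open>Suc a\<close> to the same expression.\<close>

lemma binomial_shift:
  "int (Suc k) * int ((a + Suc k) choose Suc k) = (int a + int k + 1) * int ((a + k) choose k)"
  "(int a + 1) * int ((Suc a + k) choose k) = (int a + int k + 1) * int ((a + k) choose k)"
proof -
  show "int (Suc k) * int ((a + Suc k) choose Suc k) = (int a + int k + 1) * int ((a + k) choose k)"
    using arg_cong[OF Suc_times_binomial_eq[of "a + k" k], of int]
    by (simp add: algebra_simps del: binomial_Suc_Suc)
  have "Suc a * (Suc (a + k) choose k) = Suc (a + k) * ((a + k) choose k)"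
    using binomial_absorb_comp[of "Suc (a + k)" k] by (simp add: Suc_diff_le)
  from arg_cong[OF this, of int]
  show "(int a + 1) * int ((Suc a + k) choose k) = (int a + int k + 1) * int ((a + k) choose k)"
    by (simp add: algebra_simps)
qed

lemma euler_sum_Suc:
  assumes "\<And>b. fdiff (Suc n) g b = 0"
  shows "euler_sum (Suc n) (\<lambda>a. (int a + 1) * g a) a =
           (int a + 1) * (2 * euler_sum n g a - euler_sum n g (Suc a))"
proof -
  define w where "w k = (-1) ^ k * (2::int) ^ (n - k)" for k
  define c where "c k = int ((a + k) choose k)" for k
  define h where "h k = fdiff k g a" for k
  \<comment> \<open>Everything is expressed through \<open>E\<close> and \<open>K\<close>: the left
    side is \<open>2 * E - E\<close>, while \<open>a + 1\<close> times the sums at \<open>a\<close>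
    and \<open>Suc a\<close> are \<open>E - K\<close> and \<open>E - 2 * K\<close>.\<close>
  define E where "E = (\<Sum>k\<le>n. w k * ((int a + int k + 1) * c k) * h k)"
  define K where "K = (\<Sum>k\<le>n. w k * (int k * c k) * h k)"
  have h0: "h (Suc n) = 0"
    by (simp only: h_def assms)
  have hS: "fdiff k g (Suc a) = h k + h (Suc k)" for k
    by (simp add: h_def)
  have c: "int (Suc k) * c (Suc k) = (int a + int k + 1) * c k"
          "(int a + 1) * int ((Suc a + k) choose k) = (int a + int k + 1) * c k" for k
    unfolding c_def by (rule binomial_shift)+
  have "euler_sum (Suc n) (\<lambda>a. (int a + 1) * g a) a =
      (\<Sum>k\<le>Suc n. (-1) ^ k * 2 ^ (Suc n - k) * ((int a + int k + 1) * c k) * h k) +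
      (\<Sum>k\<le>Suc n. (-1) ^ k * 2 ^ (Suc n - k) * (int k * c k) * h (k - 1))"
    unfolding euler_sum_def fdiff_mult h_def c_def
    by (simp only: sum.distrib[symmetric]) (rule sum.cong, simp_all add: algebra_simps)
  also have "(\<Sum>k\<le>Suc n. (-1) ^ k * 2 ^ (Suc n - k) * ((int a + int k + 1) * c k) * h k) = 2 * E"
    by (simp add: h0 E_def w_def sum_distrib_left Suc_diff_le mult_ac)
  also have "(\<Sum>k\<le>Suc n. (-1) ^ k * 2 ^ (Suc n - k) * (int k * c k) * h (k - 1)) = - E"
    by (subst sum.atMost_Suc_shift) (simp add: c E_def w_def sum_negf[symmetric] del: of_nat_Suc)
  finally have lhs: "euler_sum (Suc n) (\<lambda>a. (int a + 1) * g a) a = E"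
    by simp
  have 1: "(int a + 1) * euler_sum n g a = E - K"
    unfolding euler_sum_def E_def K_def sum_subtractf[symmetric] sum_distrib_left
    by (rule sum.cong) (simp_all add: w_def c_def h_def algebra_simps)
  have "(int a + 1) * euler_sum n g (Suc a) =
      (\<Sum>k\<le>n. w k * ((int a + 1) * int ((Suc a + k) choose k)) * (h k + h (Suc k)))"
    unfolding euler_sum_def hS sum_distrib_left
    by (rule sum.cong) (simp_all add: w_def mult_ac)
  also have "\<dots> = E + (\<Sum>k\<le>n. w k * (int (Suc k) * c (Suc k)) * h (Suc k))"
    unfolding c E_def by (simp add: sum.distrib[symmetric] algebra_simps)
  \<comment> \<open>The top term drops out by \<open>h0\<close>; below it, passing from
    \<open>w k\<close> to \<open>w (Suc k)\<close> costs the factor \<open>- 2\<close>.\<close>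
  also have "(\<Sum>k\<le>n. w k * (int (Suc k) * c (Suc k)) * h (Suc k)) =
      (\<Sum>k<n. - 2 * (w (Suc k) * (int (Suc k) * c (Suc k)) * h (Suc k)))"
  proof -
    have "w k = - 2 * w (Suc k)" if "k < n" for k
      using that by (simp add: w_def Suc_diff_Suc[symmetric])
    then show ?thesis
      by (simp add: lessThan_Suc_atMost[symmetric] h0 mult.assoc del: of_nat_Suc)
  qed
  also have "\<dots> = - 2 * K"
    unfolding K_def sum_distrib_left[symmetric]
    by (cases n) (simp_all add: lessThan_Suc_atMost sum.atMost_Suc_shift del: sum.atMost_Suc of_nat_Suc)
  finally show ?thesis
    using lhs 1 by (simp add: algebra_simps)
qed

section \<open>Integer polynomials from the recursion\<close>

fun ptanh :: "nat \<Rightarrow> int poly" where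
  "ptanh 0 = 1"
| "ptanh (Suc n) = [:1, 1:] * (smult 2 (ptanh n) - ptanh n \<circ>\<^sub>p [:1, 1:])"

text \<open>Both sides obey the recursion of \<open>euler_sum_Suc\<close>; its hypothesis holds
  because differences of order \<open>Suc n\<close> annihilate \<open>(a + 1) ^ n\<close>.\<close>

lemma poly_ptanh: "poly (ptanh n) (int a) = euler_sum n (\<lambda>a. (int a + 1) ^ n) a"
proof (induction n arbitrary: a)
  case 0
  then show ?case by (simp add: euler_sum_def)
next
  case (Suc n)
  have "poly (ptanh n) (1 + int a) = euler_sum n (\<lambda>a. (int a + 1) ^ n) (Suc a)"
    using Suc.IH[of "Suc a"] by simp
  then show ?case
    using euler_sum_Suc[of n "\<lambda>a. (int a + 1) ^ n" a] fdiff_power_eq_0[of n "Suc n"] Suc.IH[of a]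
    by (simp add: poly_pcompose algebra_simps)
qed

lemma poly_binom_poly: "poly (binom_poly k) (of_nat a) = of_nat ((a + k) choose k)"
proof -
  have "(\<Prod>j=1..k. of_nat j + of_nat a) = (fact k * of_nat ((a + k) choose k) :: rat)"
  proof (induction k)
    case (Suc k)
    have "rat_of_nat (Suc k) * of_nat ((a + Suc k) choose Suc k) =
        (of_nat a + of_nat k + 1) * of_nat ((a + k) choose k)"
      using arg_cong[OF binomial_shift(1)[of k a], of rat_of_int] by simp
    moreover have "(\<Prod>j=1..Suc k. rat_of_nat j + of_nat a) =
        fact k * ((of_nat a + of_nat k + 1) * of_nat ((a + k) choose k))"
      using Suc by (simp add: algebra_simps)
    ultimately show ?case
      by (simp add: mult_ac del: binomial_Suc_Suc)
  qed simp
  then show ?thesis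
    by (simp add: binom_poly_def poly_prod)
qed

lemma poly_fwd_diff:
  assumes "\<And>a. poly f (of_nat a) = of_int (g a)"
  shows "poly (fwd_diff k f) (of_nat a) = (of_int (fdiff k g a) :: 'a :: comm_ring_1)"
proof -
  have "poly f (of_nat j + of_nat a) = of_int (g (a + j))" for j
    using assms[of "a + j"] by (simp add: add.commute)
  then show ?thesis
    by (simp add: fwd_diff_def fdiff_eq_sum poly_sum poly_pcompose)
qed

lemma poly_pfrak:
  "poly (pfrak n) (of_nat a) = of_int (euler_sum n (\<lambda>a. (int a + 1) ^ n) a)"
proof -
  have "poly ([:1, 1:] ^ n) (rat_of_nat a) = of_int ((int a + 1) ^ n)" for a
    by (simp add: add.commute)
  from poly_fwd_diff[OF this] show ?thesis
    by (simp add: pfrak_def euler_sum_def poly_sum poly_binom_poly mult_ac)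
qed

lemma poly_of_int_poly: "poly (map_poly of_int q) (of_int x) = of_int (poly q x)"
  by (induction q) (auto simp: map_poly_pCons)

text \<open>The two polynomials agree at infinitely many points, namely at all naturals.\<close>

lemma pfrak_eq_ptanh: "pfrak n = map_poly of_int (ptanh n)"
proof -
  have "range rat_of_nat \<subseteq> {x. poly (pfrak n - map_poly of_int (ptanh n)) x = 0}"
    using poly_of_int_poly[where 'a = rat, of "ptanh n" "int a" for a]
    by (auto simp: poly_pfrak poly_ptanh)
  moreover have "infinite (range rat_of_nat)"
    by (simp add: finite_image_iff inj_on_def)
  ultimately show ?thesis
    using poly_roots_finite[of "pfrak n - map_poly of_int (ptanh n)"] finite_subset by auto
qed

text \<open>A shift keeps degree and leading coefficient, so the top coefficients combine to
  \<open>2 - 1 = 1\<close>.\<close>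

lemma degree_lead_coeff_diff_shift:
  fixes f :: "int poly"
  assumes "lead_coeff f = 1"
  shows "degree (smult 2 f - f \<circ>\<^sub>p [:1, 1:]) = degree f"
        "lead_coeff (smult 2 f - f \<circ>\<^sub>p [:1, 1:]) = 1"
proof -
  have d: "degree (f \<circ>\<^sub>p [:1, 1:]) = degree f"
    by (simp add: degree_pcompose)
  have l: "coeff (f \<circ>\<^sub>p [:1, 1:]) (degree f) = 1"
    using lead_coeff_comp[of "[:1, 1:]" f] assms d by simp
  have "coeff (smult 2 f - f \<circ>\<^sub>p [:1, 1:]) (degree f) = 1"
    using assms l by simp
  moreover have "degree (smult 2 f - f \<circ>\<^sub>p [:1, 1:]) \<le> degree f"
    by (rule degree_diff_le) (simp_all add: d)
  ultimately show "degree (smult 2 f - f \<circ>\<^sub>p [:1, 1:]) = degree f"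
    by (metis le_degree order_antisym zero_neq_one)
  then show "lead_coeff (smult 2 f - f \<circ>\<^sub>p [:1, 1:]) = 1"
    using assms l by simp
qed

lemma degree_lead_coeff_ptanh: "degree (ptanh n) = n \<and> lead_coeff (ptanh n) = 1"
proof (induction n)
  case (Suc n)
  let ?W = "smult 2 (ptanh n) - ptanh n \<circ>\<^sub>p [:1, 1:]"
  have W: "degree ?W = n" "lead_coeff ?W = 1"
    using Suc degree_lead_coeff_diff_shift[of "ptanh n"] by auto
  then have "?W \<noteq> 0"
    by (metis leading_coeff_0_iff zero_neq_one)
  then have "degree ([:1, 1:] * ?W) = Suc n"
    using W by (subst degree_mult_eq) auto
  moreover have "lead_coeff ([:1, 1:] * ?W) = 1"
    using W by (subst lead_coeff_mult) auto
  ultimately show ?case by simp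
qed simp


section \<open>Congruences modulo a prime\<close>

text \<open>Lagrange's bound on the number of roots modulo \<open>p\<close>: each step splits off
  the linear factor at the point \<open>m\<close>, and \<open>a - m\<close> is invertible modulo
  \<open>p\<close> for \<open>a < m < p\<close>. The case \<open>f = 0\<close> is what remains at
  \<open>m = 0\<close>.\<close>

lemma dvd_all_coeffs_if_dvd_values:
  fixes f :: "int poly"
  assumes "prime p" "m \<le> p" "degree f < m \<or> f = 0"
    and "\<And>a. a < m \<Longrightarrow> int p dvd poly f (int a)"
  shows "int p dvd coeff f i"
  using assms(2-)
proof (induction m arbitrary: f i)
  case 0
  then show ?case by simp
next
  case (Suc m)
  define c where "c = poly f (int m)"
  have "poly (f - [:c:]) (int m) = 0"
    by (simp add: c_def)
  then obtain g where g: "f - [:c:] = [:- int m, 1:] * g"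
    unfolding poly_eq_0_iff_dvd by (elim dvdE)
  then have f: "f = [:- int m, 1:] * g + [:c:]"
    by (simp add: algebra_simps)
  have c: "int p dvd c"
    using Suc.prems(3)[of m] by (simp add: c_def)
  have "degree g < m \<or> g = 0"
  proof (cases "g = 0")
    case False
    have "degree ([:- int m, 1:] * g) \<le> m"
      unfolding g[symmetric] using Suc.prems(2) by (intro degree_diff_le) auto
    moreover have "degree ([:- int m, 1:] * g) = Suc (degree g)"
      using False by (subst degree_mult_eq) auto
    ultimately show ?thesis by simp
  qed simp
  moreover have "int p dvd poly g (int a)" if "a < m" for a
  proof -
    have "poly f (int a) = (int a - int m) * poly g (int a) + c"
      unfolding f by (simp add: algebra_simps)
    then have "int p dvd (int a - int m) * poly g (int a)"
      using Suc.prems(3)[of a] c that by (simp add: dvd_add_left_iff)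
    moreover have "\<not> int p dvd int a - int m"
    proof
      assume "int p dvd int a - int m"
      then have "int p dvd int m - int a"
        by (simp add: dvd_diff_commute)
      then have "int p \<le> int m - int a"
        using that by (intro zdvd_imp_le) auto
      then show False
        using Suc.prems(1) by simp
    qed
    ultimately show ?thesis
      using assms(1) by (simp add: prime_dvd_mult_iff)
  qed
  ultimately have "int p dvd coeff g j" for j
    using Suc.IH[of g] Suc.prems(1) by simp
  then show ?case
    unfolding f using c by (auto simp: coeff_pCons split: nat.split)
qed

text \<open>Induction on \<open>a\<close>: the inner binomial coefficients of
  \<open>(a + 1) ^ p\<close> are divisible by \<open>p\<close>.\<close>

lemma int_fermat:
  assumes "prime p"
  shows "[int a ^ p = int a] (mod int p)"
proof (induction a)
  case 0
  then show ?case
    using prime_gt_0_nat[OF assms] by (simp add: zero_power)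
next
  case (Suc a)
  have "int p dvd (\<Sum>k\<in>{1..<p}. int (p choose k) * int a ^ k)"
    using assms by (intro dvd_sum dvd_mult2) (auto intro!: dvd_choose_prime)
  moreover have "(int a + 1) ^ p = (\<Sum>k\<in>{1..<p}. int (p choose k) * int a ^ k) + (int a ^ p + 1)"
  proof -
    have "{..p} = insert 0 (insert p {1..<p})"
      using prime_gt_0_nat[OF assms] by auto
    then show ?thesis
      using prime_gt_0_nat[OF assms] by (simp add: binomial_ring)
  qed
  ultimately have "[(int a + 1) ^ p = 0 + (int a ^ p + 1)] (mod int p)"
    by (simp add: cong_iff_dvd_diff)
  also have "[0 + (int a ^ p + 1) = 0 + (int a + 1)] (mod int p)"
    by (intro cong_add cong_refl Suc.IH)
  finally show ?case
    by (simp add: add.commute)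
qed

lemma ptanh_prime_value:
  assumes "prime p" "odd p"
  shows "[poly (ptanh p) (int a) = int a + 1] (mod int p)"
proof -
  obtain k where k: "p = Suc (Suc k)"
    using prime_ge_2_nat[OF assms(1)] by (metis add_2_eq_Suc le_Suc_ex)
  define w where "w \<nu> = (-1) ^ \<nu> * 2 ^ (p - \<nu>) * int ((a + \<nu>) choose \<nu>)" for \<nu>
  \<comment> \<open>The exponent 1 is kept visible so that \<open>fdiff_power_eq_0\<close> applies
    to the orders above 1.\<close>
  have f: "[fdiff \<nu> (\<lambda>a. (int a + 1) ^ p) a = fdiff \<nu> (\<lambda>a. (int a + 1) ^ 1) a] (mod int p)" for \<nu>
    using int_fermat[OF assms(1), of "Suc b" for b]
    by (intro fdiff_cong_mod) (simp add: add.commute)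
  have "[poly (ptanh p) (int a) = (\<Sum>\<nu>\<le>p. w \<nu> * fdiff \<nu> (\<lambda>a. (int a + 1) ^ 1) a)] (mod int p)"
    unfolding poly_ptanh euler_sum_def w_def by (intro cong_sum cong_mult f cong_refl)
  also have "(\<Sum>\<nu>\<le>p. w \<nu> * fdiff \<nu> (\<lambda>a. (int a + 1) ^ 1) a) =
      (\<Sum>\<nu>\<le>1. w \<nu> * fdiff \<nu> (\<lambda>a. (int a + 1) ^ 1) a)"
  proof (rule sum.mono_neutral_right)
    show "\<forall>\<nu>\<in>{..p} - {..1}. w \<nu> * fdiff \<nu> (\<lambda>a. (int a + 1) ^ 1) a = 0"
      by (intro ballI mult_eq_0_iff[THEN iffD2] disjI2 fdiff_power_eq_0) auto
  qed (use k in auto)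
  \<comment> \<open>Order 0 contributes \<open>2 ^ p * (a + 1)\<close> and order 1 contributes
    \<open>- (2 ^ (p - 1)) * (a + 1)\<close>.\<close>
  also have "\<dots> = 2 ^ (p - 1) * (int a + 1)"
    by (simp add: w_def k algebra_simps)
  also have "[2 ^ (p - 1) * (int a + 1) = 1 * (int a + 1)] (mod int p)"
  proof (intro cong_mult cong_refl)
    have "coprime 2 (int p)"
      using assms(2) by simp
    moreover have "[2 * 2 ^ (p - 1) = 2 * (1 :: int)] (mod int p)"
      using int_fermat[OF assms(1), of 2] by (simp add: k)
    ultimately show "[2 ^ (p - 1) = 1] (mod int p)"
      using cong_mult_lcancel by blast
  qed
  finally show ?thesis by simp
qed

section \<open>The power series of tanh and ln cosh\<close>

text \<open>The \<open>n\<close>-th derivative of \<open>F\<close> at 0; in this scaling,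
  differentiation is a pure index shift.\<close>

definition egf_coeff :: "nat \<Rightarrow> rat fps \<Rightarrow> rat" where
  "egf_coeff n F = fact n * F $ n"

lemma egf_coeff_Suc: "egf_coeff (Suc n) F = egf_coeff n (fps_deriv F)"
  by (simp add: egf_coeff_def algebra_simps)

lemma egf_coeff_simps:
  "egf_coeff n (F + G) = egf_coeff n F + egf_coeff n G"
  "egf_coeff n (F - G) = egf_coeff n F - egf_coeff n G"
  "egf_coeff n (of_nat k * F) = of_nat k * egf_coeff n F"
  "egf_coeff n (2 * F) = 2 * egf_coeff n F"
  by (simp_all add: egf_coeff_def algebra_simps fps_of_nat[symmetric] numeral_fps_const)

definition fps_tanh :: "rat fps" where
  "fps_tanh = (fps_exp 1 - fps_exp (-1)) * inverse (fps_exp 1 + fps_exp (-1))"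

lemma fps_tanh_nth_0: "fps_tanh $ 0 = 0"
  by (simp add: fps_tanh_def)

lemma fps_deriv_tanh: "fps_deriv fps_tanh = 1 - fps_tanh\<^sup>2"
proof -
  define S C where "S = fps_exp 1 - fps_exp (-1 :: rat)" and "C = fps_exp 1 + fps_exp (-1 :: rat)"
  have d: "fps_deriv S = C" "fps_deriv C = S"
    by (simp_all add: S_def C_def flip: fps_const_neg)
  have C0: "C $ 0 \<noteq> 0"
    by (simp add: C_def)
  then have "fps_deriv (S * inverse C) = C * inverse C - S\<^sup>2 * (inverse C)\<^sup>2"
    by (simp add: d fps_inverse_deriv power2_eq_square algebra_simps)
  also have "C * inverse C = 1"
    using C0 by (simp add: inverse_mult_eq_1')
  finally show ?thesis
    by (simp add: fps_tanh_def S_def C_def power_mult_distrib)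
qed

text \<open>Oddness of tanh read off from \<open>tanh' = 1 - tanh^2\<close>: in an odd coefficient
  of the square, each product has a factor of smaller even index, which vanishes by
  induction.\<close>

lemma fps_tanh_nth_even: "even n \<Longrightarrow> fps_tanh $ n = 0"
proof (induction n rule: less_induct)
  case (less n)
  show ?case
  proof (cases "n = 0")
    case False
    then obtain m where m: "n = Suc m" "odd m"
      using less.prems by (cases n) auto
    have "(fps_tanh\<^sup>2) $ m = (\<Sum>i=0..m. fps_tanh $ i * fps_tanh $ (m - i))"
      by (simp add: power2_eq_square fps_mult_nth)
    also have "\<dots> = 0"
    proof (rule sum.neutral, rule ballI)
      fix i assume "i \<in> {0..m}"
      then have "(even i \<and> i < n) \<or> (even (m - i) \<and> m - i < n)"
        using m by auto
      then show "fps_tanh $ i * fps_tanh $ (m - i) = 0"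
        using less.IH by auto
    qed
    finally have "fps_deriv fps_tanh $ m = 0"
      using m by (simp add: fps_deriv_tanh odd_pos)
    then show ?thesis
      using m by (simp del: of_nat_Suc)
  qed (simp add: fps_tanh_nth_0)
qed

text \<open>The antiderivative of tanh with constant term 0 is ln cosh, so no formal logarithm
  enters.\<close>

definition fps_lncosh :: "rat fps" where
  "fps_lncosh = fps_integral0 fps_tanh"

lemma fps_deriv_lncosh: "fps_deriv fps_lncosh = fps_tanh"
  by (simp add: fps_lncosh_def fps_deriv_fps_integral)

lemma fps_lncosh_nth_0: "fps_lncosh $ 0 = 0"
  by (simp add: fps_lncosh_def fps_integral_def)

lemma fps_lncosh_nth_odd: "odd n \<Longrightarrow> fps_lncosh $ n = 0"
  using fps_tanh_nth_even[of "n - 1"] by (cases n) (simp_all add: fps_lncosh_def fps_integral_def)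

text \<open>The product of the odd series tanh and the even series ln cosh is odd.\<close>

lemma fps_tanh_lncosh_nth_even:
  assumes "even n"
  shows "(fps_tanh * fps_lncosh) $ n = 0"
  unfolding fps_mult_nth
proof (rule sum.neutral, rule ballI)
  fix i assume "i \<in> {0..n}"
  then have "even i \<or> odd (n - i)"
    using assms by auto
  then show "fps_tanh $ i * fps_lncosh $ (n - i) = 0"
    by (elim disjE) (simp_all add: fps_tanh_nth_even fps_lncosh_nth_odd)
qed

text \<open>With \<open>u = 1 + tanh\<close> one has \<open>u' = 2 u - u^2\<close>. This is the
  recursion of \<open>ptanh\<close> at the level of generating functions.\<close>

lemma fps_deriv_one_plus_tanh_power:
  "fps_deriv ((1 + fps_tanh) ^ Suc a) =
     of_nat (Suc a) * (2 * (1 + fps_tanh) ^ Suc a - (1 + fps_tanh) ^ Suc (Suc a))"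
proof -
  define u where "u = 1 + fps_tanh"
  have "fps_deriv u = 2 * u - u\<^sup>2"
    by (simp add: u_def fps_deriv_tanh power2_eq_square algebra_simps)
  then have "fps_deriv (u ^ Suc a) = of_nat (Suc a) * ((2 * u - u\<^sup>2) * u ^ a)"
    by (simp only: fps_deriv_power fps_of_nat diff_Suc_1 mult.assoc)
  also have "(2 * u - u\<^sup>2) * u ^ a = 2 * u ^ Suc a - u ^ Suc (Suc a)"
    by (simp add: power2_eq_square algebra_simps)
  finally show ?thesis
    by (simp only: u_def)
qed

section \<open>Values and derivatives as Taylor coefficients\<close>

lemma ptanh_egf:
  "of_int (poly (ptanh n) (int a)) = egf_coeff n ((1 + fps_tanh) ^ Suc a)"
proof (induction n arbitrary: a)
  case 0
  then show ?case
    by (simp add: egf_coeff_def fps_tanh_nth_0 fps_mult_nth_0 fps_nth_power_0)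
next
  case (Suc n)
  show ?case
    unfolding egf_coeff_Suc fps_deriv_one_plus_tanh_power egf_coeff_simps Suc.IH[symmetric]
    by (simp add: poly_pcompose algebra_simps)
qed

text \<open>
  The right-hand side is the \<open>n\<close>-th coefficient of \<open>u ^ (a + 1) * ln u\<close>, where \<open>u = 1 + tanh t\<close> and
  \<open>ln u = t - ln (cosh t)\<close>.
\<close>

lemma pderiv_ptanh_egf:
  "of_int (poly (pderiv (ptanh n)) (int a)) =
     of_nat n * egf_coeff (n - 1) ((1 + fps_tanh) ^ Suc a) -
     egf_coeff n ((1 + fps_tanh) ^ Suc a * fps_lncosh)"
proof (induction n arbitrary: a)
  case 0
  then show ?case
    by (simp add: egf_coeff_def fps_lncosh_nth_0)
next
  case (Suc n)
  define u where "u = 1 + fps_tanh"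
  have shift: "pderiv (ptanh n \<circ>\<^sub>p [:1, 1:]) = pderiv (ptanh n) \<circ>\<^sub>p [:1, 1:]"
    by (simp add: pderiv_pcompose pderiv_pCons)
  have "pderiv (ptanh (Suc n)) =
      smult 2 (ptanh n) - ptanh n \<circ>\<^sub>p [:1, 1:] +
      [:1, 1:] * (smult 2 (pderiv (ptanh n)) - pderiv (ptanh n) \<circ>\<^sub>p [:1, 1:])"
    unfolding ptanh.simps pderiv_mult pderiv_diff pderiv_smult shift by (simp add: pderiv_pCons)
  then have "poly (pderiv (ptanh (Suc n))) (int a) =
     (2 * poly (ptanh n) (int a) - poly (ptanh n) (int (Suc a))) +
     int (Suc a) * (2 * poly (pderiv (ptanh n)) (int a) - poly (pderiv (ptanh n)) (int (Suc a)))"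
    by (simp only:) (simp add: poly_pcompose algebra_simps)
  then have lhs: "rat_of_int (poly (pderiv (ptanh (Suc n))) (int a)) =
     (2 * egf_coeff n (u ^ Suc a) - egf_coeff n (u ^ Suc (Suc a))) +
     of_nat (Suc a) *
       (2 * (of_nat n * egf_coeff (n - 1) (u ^ Suc a) - egf_coeff n (u ^ Suc a * fps_lncosh)) -
        (of_nat n * egf_coeff (n - 1) (u ^ Suc (Suc a)) - egf_coeff n (u ^ Suc (Suc a) * fps_lncosh)))"
    by (simp only: of_int_add of_int_diff of_int_mult of_int_numeral of_int_of_nat_eq
        ptanh_egf Suc.IH u_def)
  \<comment> \<open>The factor \<open>n\<close> makes the case \<open>n = 0\<close>, where
    \<open>n - 1\<close> is truncated, trivial.\<close>
  have "of_nat n * egf_coeff n (u ^ Suc a) = of_nat n * (of_nat (Suc a) *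
      (2 * egf_coeff (n - 1) (u ^ Suc a) - egf_coeff (n - 1) (u ^ Suc (Suc a))))"
    by (cases n) (simp_all add: egf_coeff_Suc fps_deriv_one_plus_tanh_power egf_coeff_simps u_def
        del: of_nat_Suc power_Suc)
  \<comment> \<open>Product rule; the last difference is \<open>u ^ Suc a\<close> times the
    derivative \<open>u - 1\<close> of ln cosh.\<close>
  moreover have "egf_coeff (Suc n) (u ^ Suc a * fps_lncosh) = egf_coeff n
      (of_nat (Suc a) * (2 * (u ^ Suc a * fps_lncosh) - u ^ Suc (Suc a) * fps_lncosh) +
       (u ^ Suc (Suc a) - u ^ Suc a))"
    unfolding egf_coeff_Suc fps_deriv_mult fps_deriv_lncosh u_def fps_deriv_one_plus_tanh_power
    by (rule arg_cong[of _ _ "egf_coeff n"]) (simp add: algebra_simps)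
  ultimately show ?case
    unfolding lhs unfolding u_def[symmetric] egf_coeff_simps
    by (simp add: algebra_simps del: power_Suc)
qed

text \<open>At \<open>a = 0\<close> the generating function is \<open>1 + tanh\<close>, whose even
  coefficients of positive index vanish.\<close>

lemma ptanh_0_even:
  assumes "even n" "n > 0"
  shows "poly (ptanh n) 0 = 0"
proof -
  have "rat_of_int (poly (ptanh n) 0) = 0"
    using ptanh_egf[of n 0] assms fps_tanh_nth_even[of n] by (simp add: egf_coeff_def)
  then show ?thesis by simp
qed

text \<open>At \<open>a = 0\<close> the product \<open>tanh * ln cosh\<close> is odd and drops out,
  and the \<open>n\<close>-th derivative of ln cosh at 0 is the \<open>(n - 1)\<close>-st of tanh.
  The latter equals that of \<open>1 + tanh\<close>, as \<open>n - 1 > 0\<close>.\<close>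

lemma pderiv_ptanh_0_even:
  assumes "even n" "n > 0"
  shows "poly (pderiv (ptanh n)) 0 = (int n - 1) * poly (ptanh (n - 1)) 0"
proof -
  obtain m where m: "n = Suc (Suc m)"
    using assms by (metis One_nat_def even_Suc gr0_conv_Suc old.nat.exhaust even_zero)
  have t: "egf_coeff (Suc m) (1 + fps_tanh) = egf_coeff (Suc m) fps_tanh"
    by (simp add: egf_coeff_def)
  have "egf_coeff n ((1 + fps_tanh) * fps_lncosh) =
      egf_coeff n fps_lncosh + egf_coeff n (fps_tanh * fps_lncosh)"
    by (simp add: egf_coeff_simps algebra_simps)
  also have "egf_coeff n (fps_tanh * fps_lncosh) = 0"
    using fps_tanh_lncosh_nth_even[OF assms(1)] by (simp add: egf_coeff_def)
  also have "egf_coeff n fps_lncosh = egf_coeff (Suc m) fps_tanh"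
    unfolding m egf_coeff_Suc[of "Suc m"] fps_deriv_lncosh ..
  finally have "rat_of_int (poly (pderiv (ptanh n)) 0) =
      of_nat n * egf_coeff (Suc m) (1 + fps_tanh) - egf_coeff (Suc m) (1 + fps_tanh)"
    using pderiv_ptanh_egf[of n 0] t m by simp
  also have "egf_coeff (Suc m) (1 + fps_tanh) = of_int (poly (ptanh (Suc m)) 0)"
    using ptanh_egf[of "Suc m" 0] by simp
  finally have "rat_of_int (poly (pderiv (ptanh n)) 0) =
      of_int ((int n - 1) * poly (ptanh (n - 1)) 0)"
    using m by (simp add: algebra_simps)
  then show ?thesis
    by (simp only: of_int_eq_iff)
qed

section \<open>Eisenstein's criterion\<close>

text \<open>Since \<open>p ^ 2\<close> does not divide the constant term of \<open>g * h\<close>,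
  \<open>p\<close> does not divide that of \<open>h\<close>. For the least \<open>i\<close> with
  \<open>coeff g i\<close> not divisible by \<open>p\<close>, coefficient \<open>i\<close> of
  \<open>g * h\<close> is congruent to \<open>coeff g i * coeff h 0\<close>, although
  \<open>i < degree (g * h)\<close>.\<close>

lemma eisenstein_at_not_dvd:
  fixes g h :: "int poly"
  assumes "eisenstein_at p (g * h)" "degree h > 0" "p dvd coeff g 0"
  shows False
proof -
  have p: "prime p" and dvd: "\<And>i. i < degree (g * h) \<Longrightarrow> p dvd coeff (g * h) i"
    and nd: "\<not> p dvd lead_coeff (g * h)" "\<not> p ^ 2 dvd coeff (g * h) 0"
    using assms(1) by (auto simp: eisenstein_at_def)
  have h0: "\<not> p dvd coeff h 0"
    using nd(2) assms(3) by (auto simp: coeff_mult_0 power2_eq_square mult_dvd_mono)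
  have "\<not> p dvd coeff g (degree g)"
    using nd(1) by (auto simp: lead_coeff_mult)
  define i where "i = (LEAST i. \<not> p dvd coeff g i)"
  have i: "\<not> p dvd coeff g i" "i \<le> degree g"
    unfolding i_def using \<open>\<not> p dvd coeff g (degree g)\<close>
    by (rule LeastI, rule Least_le)
  have lt: "p dvd coeff g j" if "j < i" for j
    using not_less_Least[of j "\<lambda>i. \<not> p dvd coeff g i"] that by (auto simp: i_def)
  have "g \<noteq> 0" "h \<noteq> 0"
    using nd(1) by auto
  then have "i < degree (g * h)"
    using i(2) assms(2) by (simp add: degree_mult_eq)
  then have "p dvd (\<Sum>j\<le>i. coeff g j * coeff h (i - j))"
    using dvd by (simp add: coeff_mult)
  also have "(\<Sum>j\<le>i. coeff g j * coeff h (i - j)) =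
      (\<Sum>j<i. coeff g j * coeff h (i - j)) + coeff g i * coeff h 0"
    by (simp add: lessThan_Suc_atMost[symmetric])
  finally have "p dvd (\<Sum>j<i. coeff g j * coeff h (i - j)) + coeff g i * coeff h 0" .
  moreover have "p dvd (\<Sum>j<i. coeff g j * coeff h (i - j))"
    using lt by (intro dvd_sum) auto
  ultimately have "p dvd coeff g i * coeff h 0"
    by (simp add: dvd_add_right_iff)
  then show False
    using p i(1) h0 by (simp add: prime_dvd_mult_iff)
qed

text \<open>One factor has constant term divisible by \<open>p\<close>, so the other is constant.
  Monicity makes that constant a unit of the integers.\<close>

lemma eisenstein_at_imp_irreducible:
  assumes "eisenstein_at p f" "lead_coeff f = 1"
  shows "irreducible f"
proof (rule irreducibleI)
  have deg: "degree f > 0"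
    using assms(1) by (simp add: eisenstein_at_def)
  then show "f \<noteq> 0" by auto
  show "\<not> is_unit f"
    using deg by (auto simp: is_unit_poly_iff)
  fix g h assume f: "f = g * h"
  have l: "lead_coeff g * lead_coeff h = 1"
    using assms(2) f by (simp add: lead_coeff_mult)
  have unit: "is_unit q" if "degree q = 0" "lead_coeff q dvd 1" for q :: "int poly"
    using that by (auto elim!: degree_eq_zeroE simp: is_unit_poly_iff)
  have "p dvd coeff g 0 * coeff h 0"
    using assms(1) f deg by (auto simp: eisenstein_at_def coeff_mult_0)
  then have "p dvd coeff g 0 \<or> p dvd coeff h 0"
    using assms(1) by (auto simp: eisenstein_at_def prime_dvd_mult_iff)
  then have "degree g = 0 \<or> degree h = 0"
    using eisenstein_at_not_dvd[of p g h] eisenstein_at_not_dvd[of p h g] assms(1) f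
    by (auto simp: mult.commute)
  then show "is_unit g \<or> is_unit h"
    using unit[of g] unit[of h] l by (metis dvd_triv_left dvd_triv_right)
qed

section \<open>The quotient polynomial and its Eisenstein property\<close>

text \<open>The factor \<open>x + 1\<close> is explicit in the recursion and equals 1 at 0, so the
  zero of \<open>ptanh n\<close> at 0 comes from the other factor.\<close>

lemma ptanh_even_factor:
  assumes "even n" "n > 0"
  obtains q where "ptanh n = [:0, 1:] * [:1, 1:] * q"
    and "smult 2 (ptanh (n - 1)) - ptanh (n - 1) \<circ>\<^sub>p [:1, 1:] = [:0, 1:] * q"
proof -
  obtain m where m: "n = Suc m"
    using assms(2) by (cases n) auto
  let ?W = "smult 2 (ptanh m) - ptanh m \<circ>\<^sub>p [:1, 1:]"
  have "poly ?W 0 = 0"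
    using ptanh_0_even[OF assms] by (simp add: m)
  then have "[:0, 1:] dvd ?W"
    by (simp only: poly_eq_0_iff_dvd minus_zero)
  then obtain q where q: "?W = [:0, 1:] * q" ..
  show thesis
  proof (rule that)
    show "smult 2 (ptanh (n - 1)) - ptanh (n - 1) \<circ>\<^sub>p [:1, 1:] = [:0, 1:] * q"
      using q by (simp only: m diff_Suc_1)
    show "ptanh n = [:0, 1:] * [:1, 1:] * q"
      unfolding m ptanh.simps q by (simp only: mult_ac)
  qed
qed

lemma of_int_poly_mult:
  "map_poly rat_of_int (f * g) = map_poly of_int f * map_poly of_int g"
  by (rule poly_eqI) (simp add: coeff_map_poly coeff_mult)

lemma of_int_poly_eq_iff: "map_poly rat_of_int f = map_poly of_int g \<longleftrightarrow> f = g"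
  by (auto simp: poly_eq_iff coeff_map_poly)

text \<open>Cancelling \<open>x (x + 1)\<close> over the rationals gives the uniqueness that the
  definite description in \<open>qfrak\<close> requires.\<close>

lemma qfrak_eqI:
  assumes "ptanh n = [:0, 1:] * [:1, 1:] * q"
  shows "qfrak n = q" "pfrak n = [:0, 1:] * [:1, 1:] * map_poly of_int q"
proof -
  have "map_poly rat_of_int ([:0, 1:] * [:1, 1:]) = [:0, 1:] * [:1, 1:]"
    by (simp add: map_poly_pCons)
  then show eq: "pfrak n = [:0, 1:] * [:1, 1:] * map_poly of_int q"
    unfolding pfrak_eq_ptanh assms of_int_poly_mult by simp
  show "qfrak n = q"
    unfolding qfrak_def
  proof (rule the_equality)
    show "pfrak n = [:0, 1:] * [:1, 1:] * map_poly of_int q"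
      by (rule eq)
  next
    fix r assume "pfrak n = [:0, 1:] * [:1, 1:] * map_poly of_int r"
    then have "[:0, 1:] * [:1, 1:] * map_poly rat_of_int r = [:0, 1:] * [:1, 1:] * map_poly of_int q"
      using eq by simp
    then have "map_poly rat_of_int r = map_poly of_int q"
      by (subst (asm) mult_cancel_left) auto
    then show "r = q"
      by (simp add: of_int_poly_eq_iff)
  qed
qed

lemma qfrak_even:
  assumes "even n" "n > 0"
  shows "pfrak n = [:0, 1:] * [:1, 1:] * map_poly of_int (qfrak n)"
    and "ptanh n = [:0, 1:] * [:1, 1:] * qfrak n"
    and "smult 2 (ptanh (n - 1)) - ptanh (n - 1) \<circ>\<^sub>p [:1, 1:] = [:0, 1:] * qfrak n"
    and "lead_coeff (qfrak n) = 1" and "degree (qfrak n) = n - 2"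
proof -
  obtain q where q: "ptanh n = [:0, 1:] * [:1, 1:] * q"
    "smult 2 (ptanh (n - 1)) - ptanh (n - 1) \<circ>\<^sub>p [:1, 1:] = [:0, 1:] * q"
    using ptanh_even_factor[OF assms] .
  note qq = qfrak_eqI[OF q(1)]
  show "pfrak n = [:0, 1:] * [:1, 1:] * map_poly of_int (qfrak n)"
    "smult 2 (ptanh (n - 1)) - ptanh (n - 1) \<circ>\<^sub>p [:1, 1:] = [:0, 1:] * qfrak n"
    using qq q by simp_all
  show eq: "ptanh n = [:0, 1:] * [:1, 1:] * qfrak n"
    using qq q by simp
  show l: "lead_coeff (qfrak n) = 1"
    using degree_lead_coeff_ptanh[of n] unfolding eq lead_coeff_mult by simp
  then have "qfrak n \<noteq> 0" by auto
  then have "degree ([:0, 1:] * [:1, 1:] * qfrak n) = 2 + degree (qfrak n)"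
    by (subst degree_mult_eq) (auto simp: degree_mult_eq)
  then have "degree (ptanh n) = 2 + degree (qfrak n)"
    by (simp only: eq[symmetric])
  then show "degree (qfrak n) = n - 2"
    using degree_lead_coeff_ptanh[of n] by simp
qed

lemma eisenstein_at_qfrak:
  assumes "prime p" "odd p"
  shows "eisenstein_at (int p) (qfrak (p + 1))"
proof -
  define n where "n = p + 1"
  define q where "q = qfrak n"
  have p3: "p > 2"
    using assms prime_ge_2_nat[OF assms(1)] by (cases "p = 2") auto
  have n: "even n" "n > 0" "n - 1 = p"
    using assms by (simp_all add: n_def)
  have eq: "ptanh n = [:0, 1:] * [:1, 1:] * q"
    "smult 2 (ptanh p) - ptanh p \<circ>\<^sub>p [:1, 1:] = [:0, 1:] * q"
    and q: "lead_coeff q = 1" "degree q = p - 1"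
    using qfrak_even[OF n(1,2)] n(3) by (simp_all add: q_def n_def)
  \<comment> \<open>Both terms are monic of degree \<open>p\<close>, so the degree of
    \<open>?D\<close> falls below \<open>p\<close>, or \<open>?D\<close> is 0, and the
    \<open>p\<close> values at \<open>0, ..., p - 1\<close> control all coefficients.\<close>
  let ?D = "[:0, 1:] * q - monom 1 p"
  have D: "int p dvd coeff ?D i" for i
  proof (rule dvd_all_coeffs_if_dvd_values[OF assms(1) order_refl])
    have d: "degree ([:0, 1:] * q) = p" "lead_coeff ([:0, 1:] * q) = 1"
      using degree_lead_coeff_diff_shift[of "ptanh p"] degree_lead_coeff_ptanh[of p]
      unfolding eq(2) by auto
    then have "degree ?D \<le> p"
      by (intro degree_diff_le) (auto simp: degree_monom_le)
    moreover have "coeff ?D p = 0"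
      using d by simp
    ultimately show "degree ?D < p \<or> ?D = 0"
      by (metis le_neq_implies_less leading_coeff_0_iff)
  next
    fix a
    have "[poly ([:0, 1:] * q) (int a) = 2 * (int a + 1) - (int (Suc a) + 1)] (mod int p)"
      unfolding eq(2)[symmetric]
      using cong_diff[OF cong_mult[OF cong_refl[of 2] ptanh_prime_value[OF assms, of a]]
          ptanh_prime_value[OF assms, of "Suc a"]]
      by (simp add: poly_pcompose)
    moreover have "[int a ^ p = int a] (mod int p)"
      by (rule int_fermat[OF assms(1)])
    ultimately have "[poly ([:0, 1:] * q) (int a) = int a ^ p] (mod int p)"
      by (simp add: cong_def)
    then show "int p dvd poly ?D (int a)"
      by (simp add: poly_monom cong_iff_dvd_diff)
  qed
  \<comment> \<open>Coefficient \<open>i\<close> of \<open>q\<close> is coefficient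
    \<open>Suc i\<close> of \<open>x q\<close>, and \<open>Suc i < p\<close> keeps clear of the
    monomial.\<close>
  have "int p dvd coeff q i" if "i < degree q" for i
    using D[of "Suc i"] that q(2) by (auto split: if_splits)
  moreover have "\<not> (int p)\<^sup>2 dvd coeff q 0"
  proof
    assume "(int p)\<^sup>2 dvd coeff q 0"
    \<comment> \<open>The derivative of \<open>x (x + 1) q\<close> at 0 is the value of
      \<open>(x + 1) q\<close> there.\<close>
    moreover have "poly (pderiv (ptanh n)) 0 = coeff q 0"
      unfolding eq(1) pderiv_mult by (simp add: pderiv_pCons poly_0_coeff_0)
    then have "coeff q 0 = int p * poly (ptanh p) 0"
      using pderiv_ptanh_0_even[OF n(1,2)] n(3) by (simp add: n_def)
    ultimately have "int p dvd poly (ptanh p) 0"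
      using p3 by (simp add: power2_eq_square)
    moreover have "[poly (ptanh p) 0 = 1] (mod int p)"
      using ptanh_prime_value[OF assms, of 0] by simp
    ultimately have "int p dvd 1"
      using cong_dvd_iff by blast
    then show False
      using p3 by simp
  qed
  ultimately show ?thesis
    using assms(1) p3 q by (simp add: eisenstein_at_def q_def n_def)
qed

theorem theorem1p4:
  shows "(\<forall>n\<ge>4. even n \<longrightarrow>
            pfrak n = [:0, 1:] * [:1, 1:] * map_poly of_int (qfrak n) \<and>
            lead_coeff (qfrak n) = 1 \<and> degree (qfrak n) = n - 2) \<and>
         (\<forall>p::nat. prime p \<and> odd p \<longrightarrow>
            eisenstein_at (int p) (qfrak (p + 1)) \<and> irreducible (qfrak (p + 1)))"
proof (intro conjI allI impI)
  fix n :: nat assume "4 \<le> n" "even n"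
  then show "pfrak n = [:0, 1:] * [:1, 1:] * map_poly of_int (qfrak n)"
    "lead_coeff (qfrak n) = 1" "degree (qfrak n) = n - 2"
    using qfrak_even(1,4,5)[of n] by simp_all
next
  fix p :: nat assume p: "prime p \<and> odd p"
  then show "eisenstein_at (int p) (qfrak (p + 1))"
    by (intro eisenstein_at_qfrak) simp_all
  then show "irreducible (qfrak (p + 1))"
    using qfrak_even(4)[of "p + 1"] p eisenstein_at_imp_irreducible by simp
qed

end
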